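(* Let $n,m\ge 1$. Suppose $X_1,\ldots,X_n$ are independent and identically distributed random variables from a probability measure $P_X$ supported on a measurable space $\mathcal{Z}$, and $Y_1,\ldots,Y_m$ are independent and identically distributed random variables from a probability measure $P_Y$ supported also on $\mathcal{Z}$, with $(X_1,\ldots,X_n)$ independent of $(Y_1,\ldots,Y_m)$. Let $\widehat{f}_{n+m}:\mathcal{Z}\to\mathbb{R}$ be any (measurable) data-dependent transformation depending permutation invariantly on $X_1,\ldots,X_n,Y_1,\ldots,Y_m$. Then, under $H_0: P_X=P_Y$, the statistic $$T_n^{\mathrm{exch}} := \sum_{i=1}^n \mathrm{rank}\big(\widehat{f}_{n+m}(X_i);\,\{\widehat{f}_{n+m}(X_1),\ldots,\widehat{f}_{n+m}(X_n),\widehat{f}_{n+m}(Y_1),\ldots,\widehat{f}_{n+m}(Y_m)\}\big)$$ is distribution-free (its distribution does not depend on the common distribution $P_X=P_Y$), and its distribution equals the null distribution of the Wilcoxon rank sum statistic with sample sizes $n$ and $m$.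
   Context: Permutation invariance: put $Z_i=X_i$ for $1\le i\le n$ and $Z_{n+i}=Y_i$ for $1\le i\le m$. The transformation has the form $\widehat{f}_{n+m}(z)=\widehat{f}_{n+m}(z;Z_1,\ldots,Z_{n+m})$, i.e. it is a fixed measurable real-valued function of $z$ and of the data, and for every $z\in\mathcal{Z}$, all data values, and every permutation $\pi$ of $\{1,\ldots,n+m\}$, $$\widehat{f}_{n+m}(z;Z_1,\ldots,Z_{n+m})=\widehat{f}_{n+m}(z;Z_{\pi(1)},\ldots,Z_{\pi(n+m)}).$$ Rank (with random tie-breaking): for a finite sequence of real numbers $x_1,\ldots,x_N$ (ties allowed, the collection $\{x_1,\ldots,x_N\}$ being understood as an indexed collection), fix an arbitrary $\xi>0$ and let $U_1,\ldots,U_N$ be i.i.d. $\mathrm{Unif}[-1,1]$, independent of all the data; the same $U_1,\ldots,U_N$ are used for all the ranks in the collection. Then $$\mathrm{rank}(x_i;\{x_1,\ldots,x_N\}) := |\{j\in\{1,\ldots,N\}: x_j+\xi U_j\le x_i+\xi U_i\}|.$$ Distributions of ranks are computed including the randomness of $U_1,\ldots,U_N$. Wilcoxon rank sum statistic: for real-valued data $Z_1,\ldots,Z_{n+m}$ consisting of $n$ i.i.d. observations from $P_X$ followed by $m$ i.i.d. observations from $P_Y$ (both samples independent), it is $T_n:=\sum_{i=1}^n\mathrm{rank}(Z_i;\{Z_1,\ldots,Z_{n+m}\})$; its null distribution is its distribution when $P_X=P_Y$ (this does not depend on the common distribution). *)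

theory Defs
  imports "HOL-Probability.Probability"
begin

definition iid :: "'w measure \<Rightarrow> 'z measure \<Rightarrow> 'z measure \<Rightarrow> 'i set \<Rightarrow> ('i \<Rightarrow> 'w \<Rightarrow> 'z) \<Rightarrow> bool" where
  "iid M Z P I X \<longleftrightarrow>
     prob_space.indep_vars M (\<lambda>_. Z) X I \<and> (\<forall>i\<in>I. distr M Z (X i) = P)"

text \<open>
  The library's \<open>indep_var\<close> forces both random variables to have the same value type; this is its
  heterogeneous counterpart (the inverse images already form sigma algebras).
\<close>

definition indep_rvs ::
  "'w measure \<Rightarrow> 'a measure \<Rightarrow> ('w \<Rightarrow> 'a) \<Rightarrow> 'b measure \<Rightarrow> ('w \<Rightarrow> 'b) \<Rightarrow> bool" where
  "indep_rvs M S A T B \<longleftrightarrow>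
     A \<in> measurable M S \<and> B \<in> measurable M T \<and>
     prob_space.indep_set M {A -` E \<inter> space M |E. E \<in> sets S} {B -` E \<inter> space M |E. E \<in> sets T}"

definition pooled :: "nat \<Rightarrow> nat \<Rightarrow> (nat \<Rightarrow> 'z) \<Rightarrow> (nat \<Rightarrow> 'z) \<Rightarrow> nat \<Rightarrow> 'z" where
  "pooled n m x y = (\<lambda>i\<in>{1..n + m}. if i \<le> n then x i else y (i - n))"

text \<open>
  \<open>Z\<close> serves only as a measurable space (its measure plays no role).  The variables
  \<open>U 1, \<dots>, U (n + m)\<close> are the random tie-breakers.
\<close>

locale two_sample_model = prob_space M
  for M :: "'w measure" +
  fixes Z P_X P_Y :: "'z measure" and n m :: nat
    and X Y :: "nat \<Rightarrow> 'w \<Rightarrow> 'z" and U :: "nat \<Rightarrow> 'w \<Rightarrow> real"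
  assumes prob_P_X: "prob_space P_X" and sets_P_X: "sets P_X = sets Z"
    and prob_P_Y: "prob_space P_Y" and sets_P_Y: "sets P_Y = sets Z"
    and iid_X: "iid M Z P_X {1..n} X"
    and iid_Y: "iid M Z P_Y {1..m} Y"
    and indep_X_Y:
      "indep_var (PiM {1..n} (\<lambda>_. Z)) (\<lambda>\<omega>. \<lambda>i\<in>{1..n}. X i \<omega>)
                 (PiM {1..m} (\<lambda>_. Z)) (\<lambda>\<omega>. \<lambda>i\<in>{1..m}. Y i \<omega>)"
    and iid_U: "iid M borel (uniform_measure lborel {-1..1}) {1..n + m} U"
    and indep_data_U:
      "indep_rvs M (PiM {1..n + m} (\<lambda>_. Z)) (\<lambda>\<omega>. pooled n m (\<lambda>i. X i \<omega>) (\<lambda>i. Y i \<omega>))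
                 (PiM {1..n + m} (\<lambda>_. borel)) (\<lambda>\<omega>. \<lambda>i\<in>{1..n + m}. U i \<omega>)"

text \<open>
  Rank of \<open>x i\<close> in the indexed collection \<open>x 1, \<dots>, x N\<close>, where \<open>u\<close> is the realisation of
  the tie-breakers.
\<close>

definition rank_tb :: "real \<Rightarrow> nat \<Rightarrow> (nat \<Rightarrow> real) \<Rightarrow> (nat \<Rightarrow> real) \<Rightarrow> nat \<Rightarrow> nat" where
  "rank_tb \<xi> N u x i = card {j \<in> {1..N}. x j + \<xi> * u j \<le> x i + \<xi> * u i}"

definition rank_sum :: "real \<Rightarrow> nat \<Rightarrow> nat \<Rightarrow> (nat \<Rightarrow> real) \<Rightarrow> (nat \<Rightarrow> real) \<Rightarrow> nat" where
  "rank_sum \<xi> n m u x = (\<Sum>i = 1..n. rank_tb \<xi> (n + m) u x i)"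

definition wilcoxon_stat ::
  "real \<Rightarrow> nat \<Rightarrow> nat \<Rightarrow> (nat \<Rightarrow> 'w \<Rightarrow> real) \<Rightarrow> (nat \<Rightarrow> 'w \<Rightarrow> real) \<Rightarrow> (nat \<Rightarrow> 'w \<Rightarrow> real) \<Rightarrow> 'w \<Rightarrow> nat" where
  "wilcoxon_stat \<xi> n m X Y U \<omega> =
     rank_sum \<xi> n m (\<lambda>i. U i \<omega>) (pooled n m (\<lambda>i. X i \<omega>) (\<lambda>i. Y i \<omega>))"

text \<open>
  A data-dependent transformation is \<open>f z d\<close>, with \<open>z\<close> the evaluation point and \<open>d\<close> the pooled data.
\<close>

definition exch_stat ::
  "real \<Rightarrow> nat \<Rightarrow> nat \<Rightarrow> ('z \<Rightarrow> (nat \<Rightarrow> 'z) \<Rightarrow> real) \<Rightarrow>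
   (nat \<Rightarrow> 'w \<Rightarrow> 'z) \<Rightarrow> (nat \<Rightarrow> 'w \<Rightarrow> 'z) \<Rightarrow> (nat \<Rightarrow> 'w \<Rightarrow> real) \<Rightarrow> 'w \<Rightarrow> nat" where
  "exch_stat \<xi> n m f X Y U \<omega> =
     (let d = pooled n m (\<lambda>i. X i \<omega>) (\<lambda>i. Y i \<omega>)
      in rank_sum \<xi> n m (\<lambda>i. U i \<omega>) (\<lambda>i. f (d i) d))"

definition perm_invariant :: "'z measure \<Rightarrow> nat \<Rightarrow> ('z \<Rightarrow> (nat \<Rightarrow> 'z) \<Rightarrow> real) \<Rightarrow> bool" where
  "perm_invariant Z N f \<longleftrightarrow>
     (\<forall>z\<in>space Z. \<forall>d\<in>space (PiM {1..N} (\<lambda>_. Z)). \<forall>\<pi>. \<pi> permutes {1..N} \<longrightarrow>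
        f z d = f z (\<lambda>i\<in>{1..N}. d (\<pi> i)))"

end

theory Submission
  imports Defs
begin

text \<open>
  Put \<open>W i = f (d i) d + \<xi> * u i\<close>, where \<open>d\<close> is the pooled sample and \<open>u\<close> the tie-breakers.  Under the
  null hypothesis \<open>(d, u)\<close> is a pair of independent i.i.d. vectors, and by the permutation invariance
  of \<open>f\<close> permuting both vectors by \<open>\<pi>\<close> just permutes \<open>W\<close>, so \<open>W\<close> is exchangeable; it is almost surely
  free of ties because, given \<open>d\<close>, a tie fixes the difference of two independent atomless variables.

  By exchangeability, the probability that the rank sum of \<open>W\<close> lies in \<open>A\<close> is the expected proportion
  of permutations \<open>\<pi>\<close> for which the rank sum of \<open>W \<circ> \<pi>\<close> lies in \<open>A\<close>.  When \<open>W\<close> has no ties, its rank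
  vector \<open>r\<close> is a permutation and the rank vector of \<open>W \<circ> \<pi>\<close> is \<open>r \<circ> \<pi>\<close>, so this proportion does not
  depend on \<open>W\<close>.  The Wilcoxon statistic is the special case \<open>f z d = z\<close>.
\<close>

section \<open>Combinatorics of rank sums\<close>

text \<open>Tie-breakers are already added into \<open>w\<close>, so ranks depend on a single real
  vector and only its exchangeability matters later.\<close>

definition raw_rank_sum :: "nat \<Rightarrow> nat \<Rightarrow> (nat \<Rightarrow> real) \<Rightarrow> nat" where
  "raw_rank_sum n N w = (\<Sum>i = 1..n. card {j \<in> {1..N}. w j \<le> w i})"

lemma rank_sum_eq_raw_rank_sum:
  "rank_sum \<xi> n m u x = raw_rank_sum n (n + m) (\<lambda>i. x i + \<xi> * u i)"
  by (simp add: rank_sum_def rank_tb_def raw_rank_sum_def)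

text \<open>Elements of the product space are restricted to \<open>{1..N}\<close>. This lemma adds
  or drops that restriction; \<open>n \<le> N\<close> keeps every evaluated index inside.\<close>

lemma raw_rank_sum_cong:
  assumes "n \<le> N" "\<And>i. i \<in> {1..N} \<Longrightarrow> w i = w' i"
  shows "raw_rank_sum n N w = raw_rank_sum n N w'"
  unfolding raw_rank_sum_def using assms
  by (intro sum.cong refl arg_cong[where f = card]) auto

lemma measurable_raw_rank_sum:
  assumes "n \<le> N"
  shows "raw_rank_sum n N \<in> measurable (PiM {1..N} (\<lambda>_. borel)) (count_space UNIV)"
  unfolding raw_rank_sum_def
proof (intro measurable_sum_nat measurable_card)
  fix i j assume i: "i \<in> {1..n}"
  let ?B = "PiM {1..N} (\<lambda>_. borel :: real measure)"
  show "{w \<in> space ?B. j \<in> {j \<in> {1..N}. w j \<le> w i}} \<in> sets ?B"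
  proof (cases "j \<in> {1..N}")
    case True
    have [measurable]: "(\<lambda>w. w j) \<in> borel_measurable ?B" "(\<lambda>w. w i) \<in> borel_measurable ?B"
      using True i assms by auto
    have "{w \<in> space ?B. w j \<le> w i} \<in> sets ?B"
      by measurable
    with True show ?thesis by (simp only: mem_Collect_eq simp_thms)
  next
    case False
    then show ?thesis by (simp only: mem_Collect_eq simp_thms Set.empty_def[symmetric] sets.empty_sets)
  qed
qed

text \<open>Relabelling does not change how many values lie below a threshold. This is what makes
  ranks travel with their indices.\<close>

lemma card_le_permutes:
  fixes w :: "'a \<Rightarrow> 'b :: linorder"
  assumes "\<pi> permutes I"
  shows "card {j \<in> I. w (\<pi> j) \<le> c} = card {j \<in> I. w j \<le> c}"
proof (rule bij_betw_same_card[of \<pi>])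
  show "bij_betw \<pi> {j \<in> I. w (\<pi> j) \<le> c} {j \<in> I. w j \<le> c}"
    using assms
    by (auto simp: bij_betw_def permutes_inj_on[OF assms] permutes_in_image image_iff
        intro!: inj_on_subset[OF permutes_inj[OF assms]])
       (metis permutes_def)
qed

text \<open>For distinct values the rank is strictly increasing in the value, hence injective. An
  injective self-map of a finite set is a bijection.\<close>

lemma rank_permutes:
  fixes w :: "nat \<Rightarrow> 'b :: linorder"
  assumes inj: "inj_on w {1..N}"
  obtains r where "r permutes {1..N}"
    "\<And>i. i \<in> {1..N} \<Longrightarrow> r i = card {j \<in> {1..N}. w j \<le> w i}"
proof -
  \<comment> \<open>The value \<open>i\<close> outside the index set is what \<open>permutes\<close>
    demands.\<close>
  define r where "r i = (if i \<in> {1..N} then card {j \<in> {1..N}. w j \<le> w i} else i)" for i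
  have less: "r i < r k" if "i \<in> {1..N}" "k \<in> {1..N}" "w i < w k" for i k
  proof -
    have "{j \<in> {1..N}. w j \<le> w i} \<subset> {j \<in> {1..N}. w j \<le> w k}"
    proof (rule psubsetI)
      show "{j \<in> {1..N}. w j \<le> w i} \<subseteq> {j \<in> {1..N}. w j \<le> w k}"
        using that(3) by auto
      have "k \<in> {j \<in> {1..N}. w j \<le> w k}" "k \<notin> {j \<in> {1..N}. w j \<le> w i}"
        using that by simp_all
      then show "{j \<in> {1..N}. w j \<le> w i} \<noteq> {j \<in> {1..N}. w j \<le> w k}" by blast
    qed
    then have "card {j \<in> {1..N}. w j \<le> w i} < card {j \<in> {1..N}. w j \<le> w k}"
      by (rule psubset_card_mono[rotated]) simp
    then show ?thesis by (simp only: r_def that if_True)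
  qed
  have "inj_on r {1..N}"
  proof (rule inj_onI, rule ccontr)
    fix i k assume ik: "i \<in> {1..N}" "k \<in> {1..N}" "r i = r k" "i \<noteq> k"
    then have "w i < w k \<or> w k < w i" using inj_onD[OF inj] by (metis linorder_neqE)
    then show False using less[of i k] less[of k i] ik by auto
  qed
  moreover have "r ` {1..N} \<subseteq> {1..N}"
  proof (clarsimp simp: r_def)
    fix i assume i: "Suc 0 \<le> i" "i \<le> N"
    let ?A = "{j. Suc 0 \<le> j \<and> j \<le> N \<and> w j \<le> w i}"
    have fin: "finite ?A" by (rule finite_subset[of _ "{1..N}"]) auto
    \<comment> \<open>Each index counts itself, so ranks start at 1.\<close>
    have "card ?A > 0" using i fin by (auto simp: card_gt_0_iff)
    moreover have "card ?A \<le> card {1..N}" by (rule card_mono) auto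
    ultimately show "Suc 0 \<le> card ?A \<and> card ?A \<le> N" by simp
  qed
  ultimately have "bij_betw r {1..N} {1..N}"
    by (simp add: bij_betw_def endo_inj_surj)
  then have "r permutes {1..N}"
    by (rule bij_imp_permutes) (simp only: r_def if_False)
  then show thesis by (rule that) (simp add: r_def)
qed

text \<open>Composing on the left with the rank permutation \<open>r\<close> maps the first set
  bijectively onto the second. The right-hand side is free of \<open>w\<close>, which is the source
  of distribution-freeness.\<close>

lemma card_permutations_raw_rank_sum:
  assumes "n \<le> N" and inj: "inj_on w {1..N}"
  shows "card {\<pi>. \<pi> permutes {1..N} \<and> raw_rank_sum n N (\<lambda>i. w (\<pi> i)) \<in> A}
       = card {\<sigma>. \<sigma> permutes {1..N} \<and> (\<Sum>i = 1..n. \<sigma> i) \<in> A}"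
proof -
  obtain r where r: "r permutes {1..N}"
    "\<And>i. i \<in> {1..N} \<Longrightarrow> r i = card {j \<in> {1..N}. w j \<le> w i}"
    using rank_permutes[OF inj] by metis
  have eq: "raw_rank_sum n N (\<lambda>i. w (\<pi> i)) = (\<Sum>i = 1..n. (r \<circ> \<pi>) i)" if \<pi>: "\<pi> permutes {1..N}" for \<pi>
    unfolding raw_rank_sum_def
  proof (rule sum.cong[OF refl])
    fix i assume "i \<in> {1..n}"
    then have "\<pi> i \<in> {1..N}" using assms(1) permutes_in_image[OF \<pi>, of i] by auto
    then show "card {j \<in> {1..N}. w (\<pi> j) \<le> w (\<pi> i)} = (r \<circ> \<pi>) i"
      using card_le_permutes[OF \<pi>, of w "w (\<pi> i)"] r(2) by simp
  qed
  have ri: "inv r permutes {1..N}" using r(1) by (rule permutes_inv)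
  show ?thesis
  proof (rule bij_betw_same_card[of "\<lambda>\<pi>. r \<circ> \<pi>"], rule bij_betw_byWitness[where f' = "\<lambda>\<sigma>. inv r \<circ> \<sigma>"])
    show "\<forall>\<pi>\<in>{\<pi>. \<pi> permutes {1..N} \<and> raw_rank_sum n N (\<lambda>i. w (\<pi> i)) \<in> A}. inv r \<circ> (r \<circ> \<pi>) = \<pi>"
      using permutes_inv_o(2)[OF r(1)] by (simp add: o_assoc)
    show "\<forall>\<sigma>\<in>{\<sigma>. \<sigma> permutes {1..N} \<and> (\<Sum>i = 1..n. \<sigma> i) \<in> A}. r \<circ> (inv r \<circ> \<sigma>) = \<sigma>"
      using permutes_inv_o(1)[OF r(1)] by (simp add: o_assoc)
    show "(\<lambda>\<pi>. r \<circ> \<pi>) ` {\<pi>. \<pi> permutes {1..N} \<and> raw_rank_sum n N (\<lambda>i. w (\<pi> i)) \<in> A}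
        \<subseteq> {\<sigma>. \<sigma> permutes {1..N} \<and> (\<Sum>i = 1..n. \<sigma> i) \<in> A}"
      using r(1) by (auto simp: eq intro: permutes_compose)
    show "(\<lambda>\<sigma>. inv r \<circ> \<sigma>) ` {\<sigma>. \<sigma> permutes {1..N} \<and> (\<Sum>i = 1..n. \<sigma> i) \<in> A}
        \<subseteq> {\<pi>. \<pi> permutes {1..N} \<and> raw_rank_sum n N (\<lambda>i. w (\<pi> i)) \<in> A}"
    proof clarify
      fix \<sigma> assume \<sigma>: "\<sigma> permutes {1..N}" "(\<Sum>i = 1..n. \<sigma> i) \<in> A"
      have p: "inv r \<circ> \<sigma> permutes {1..N}" using \<sigma>(1) ri by (rule permutes_compose)
      have "r \<circ> (inv r \<circ> \<sigma>) = \<sigma>"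
        using permutes_inv_o(1)[OF r(1)] by (simp add: o_assoc)
      with eq[OF p] \<sigma>(2) p
      show "inv r \<circ> \<sigma> permutes {1..N} \<and> raw_rank_sum n N (\<lambda>i. w ((inv r \<circ> \<sigma>) i)) \<in> A"
        by metis
    qed
  qed
qed

section \<open>The rank sum of an exchangeable vector without ties\<close>

text \<open>For \<open>n \<le> N\<close> this is the law of the total of \<open>n\<close> draws
  without replacement from \<open>{1..N}\<close>. Both statistics are compared through it.\<close>

definition null_rank_sum :: "nat \<Rightarrow> nat \<Rightarrow> nat pmf" where
  "null_rank_sum n N = map_pmf (\<lambda>\<sigma>. \<Sum>i = 1..n. \<sigma> i) (pmf_of_set {\<sigma>. \<sigma> permutes {1..N}})"

text \<open>Double counting of pairs of an outcome and a permutation: exchangeability gives all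
  events \<open>E \<pi>\<close> the same probability, while almost every outcome lies in the same
  number of them.\<close>

lemma (in prob_space) distr_raw_rank_sum_exchangeable:
  fixes W :: "'a \<Rightarrow> nat \<Rightarrow> real"
  assumes "n \<le> N"
    and W: "W \<in> measurable M (PiM {1..N} (\<lambda>_. borel))"
    and exch: "\<And>\<pi>. \<pi> permutes {1..N} \<Longrightarrow>
      distr M (PiM {1..N} (\<lambda>_. borel)) (\<lambda>\<omega>. \<lambda>i\<in>{1..N}. W \<omega> (\<pi> i)) = distr M (PiM {1..N} (\<lambda>_. borel)) W"
    and inj: "AE \<omega> in M. inj_on (W \<omega>) {1..N}"
  shows "distr M (count_space UNIV) (\<lambda>\<omega>. raw_rank_sum n N (W \<omega>)) = measure_pmf (null_rank_sum n N)"
proof (rule measure_eqI)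
  let ?I = "{1..N}" let ?B = "PiM ?I (\<lambda>_. borel :: real measure)"
  let ?S = "{\<pi>. \<pi> permutes ?I}"
  fix A assume "A \<in> sets (distr M (count_space UNIV) (\<lambda>\<omega>. raw_rank_sum n N (W \<omega>)))"
  note R = measurable_raw_rank_sum[OF assms(1)]
  let ?c = "card {\<sigma>. \<sigma> permutes ?I \<and> (\<Sum>i = 1..n. \<sigma> i) \<in> A}"
  have S: "finite ?S" "?S \<noteq> {}" "card ?S > 0"
    using finite_permutations[of ?I] permutes_id[of ?I]
    by (auto simp: card_gt_0_iff simp del: One_nat_def intro: exI[of _ id])
  define E where "E \<pi> = {\<omega> \<in> space M. raw_rank_sum n N (\<lambda>i. W \<omega> (\<pi> i)) \<in> A}" for \<pi> :: "nat \<Rightarrow> nat"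
  have W\<pi>: "(\<lambda>\<omega>. \<lambda>i\<in>?I. W \<omega> (\<pi> i)) \<in> measurable M ?B" if "\<pi> permutes ?I" for \<pi>
  proof (rule measurable_restrict)
    fix i assume "i \<in> ?I"
    then have "\<pi> i \<in> ?I" using permutes_in_image[OF that, of i] by auto
    then show "(\<lambda>\<omega>. W \<omega> (\<pi> i)) \<in> borel_measurable M"
      using measurable_compose[OF W measurable_component_singleton[of "\<pi> i" ?I "\<lambda>_. borel"]] by simp
  qed
  have E: "E \<pi> \<in> events" "emeasure M (E \<pi>) = emeasure M (E id)" if \<pi>: "\<pi> permutes ?I" for \<pi>
  proof -
    \<comment> \<open>Written as a preimage under the restricted permuted vector, the event becomes
      accessible to \<open>exch\<close>.\<close>
    have *: "E \<pi> = (\<lambda>\<omega>. \<lambda>i\<in>?I. W \<omega> (\<pi> i)) -` (raw_rank_sum n N -` A \<inter> space ?B) \<inter> space M"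
      if \<pi>: "\<pi> permutes ?I" for \<pi>
      using measurable_space[OF W\<pi>[OF \<pi>]] raw_rank_sum_cong[OF assms(1), of "\<lambda>i. W _ (\<pi> i)" "\<lambda>i\<in>?I. W _ (\<pi> i)"]
      by (auto simp: E_def)
    have A: "raw_rank_sum n N -` A \<inter> space ?B \<in> sets ?B"
      using R by (rule measurable_sets) simp
    show "E \<pi> \<in> events" unfolding *[OF \<pi>] using W\<pi>[OF \<pi>] A by (rule measurable_sets)
    have "emeasure M (E \<pi>) = emeasure (distr M ?B W) (raw_rank_sum n N -` A \<inter> space ?B)" if \<pi>: "\<pi> permutes ?I" for \<pi>
      unfolding *[OF \<pi>] exch[OF \<pi>, symmetric] using W\<pi>[OF \<pi>] A by (simp add: emeasure_distr)
    from this[OF \<pi>] this[OF permutes_id] show "emeasure M (E \<pi>) = emeasure M (E id)" by simp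
  qed
  have "of_nat (card ?S) * emeasure M (E id) = (\<Sum>\<pi>\<in>?S. emeasure M (E \<pi>))"
    using sum.cong[of ?S ?S "\<lambda>\<pi>. emeasure M (E \<pi>)" "\<lambda>_. emeasure M (E id)"] E(2)
    by (simp only: sum_constant mem_Collect_eq simp_thms)
  also have "\<dots> = (\<Sum>\<pi>\<in>?S. \<integral>\<^sup>+\<omega>. indicator (E \<pi>) \<omega> \<partial>M)"
    using E(1) by simp
  also have "\<dots> = (\<integral>\<^sup>+\<omega>. (\<Sum>\<pi>\<in>?S. indicator (E \<pi>) \<omega>) \<partial>M)"
    using E(1) by (intro nn_integral_sum[symmetric]) auto
  also have "\<dots> = (\<integral>\<^sup>+\<omega>. of_nat ?c \<partial>M)"
  proof (rule nn_integral_cong_AE)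
    \<comment> \<open>Absence of ties enters here: it makes the number of favourable permutations
      the constant \<open>?c\<close>.\<close>
    show "AE \<omega> in M. (\<Sum>\<pi>\<in>?S. indicator (E \<pi>) \<omega>) = (of_nat ?c :: ennreal)"
      using inj AE_space
    proof eventually_elim
      case (elim \<omega>)
      have "(\<Sum>\<pi>\<in>?S. indicator (E \<pi>) \<omega>) = (of_nat (card {\<pi> \<in> ?S. \<omega> \<in> E \<pi>}) :: ennreal)"
        using S(1) by (simp add: indicator_def sum.If_cases Int_def)
      also have "{\<pi> \<in> ?S. \<omega> \<in> E \<pi>} = {\<pi>. \<pi> permutes ?I \<and> raw_rank_sum n N (\<lambda>i. W \<omega> (\<pi> i)) \<in> A}"
        using elim(2) by (auto simp: E_def)
      finally show ?case
        using card_permutations_raw_rank_sum[OF assms(1) elim(1)] by simp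
    qed
  qed
  also have "\<dots> = of_nat ?c" by (simp add: emeasure_space_1)
  finally have eq: "of_nat (card ?S) * emeasure M (E id) = of_nat ?c" .
  \<comment> \<open>The identity moves from \<open>ennreal\<close> to the reals so that it can be
    divided by \<open>card ?S\<close>.\<close>
  have "real (card ?S) * prob (E id) = real ?c"
    using arg_cong[OF eq, of enn2real] by (simp add: enn2real_mult measure_def)
  then have "prob (E id) = real ?c / real (card ?S)"
    using S(3) by (simp add: field_simps)
  moreover have "emeasure (distr M (count_space UNIV) (\<lambda>\<omega>. raw_rank_sum n N (W \<omega>))) A = emeasure M (E id)"
    using measurable_compose[OF W R] by (subst emeasure_distr) (auto simp: E_def intro!: arg_cong[where f = "emeasure M"])
  moreover have "?S \<inter> (\<lambda>\<sigma>. \<Sum>i = 1..n. \<sigma> i) -` A = {\<sigma>. \<sigma> permutes ?I \<and> (\<Sum>i = 1..n. \<sigma> i) \<in> A}"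
    by auto
  then have "emeasure (null_rank_sum n N) A = ennreal (real ?c / real (card ?S))"
    unfolding null_rank_sum_def using S(1,2) by (simp add: emeasure_pmf_of_set)
  ultimately show "emeasure (distr M (count_space UNIV) (\<lambda>\<omega>. raw_rank_sum n N (W \<omega>))) A
      = emeasure (measure_pmf (null_rank_sum n N)) A"
    by (simp only: emeasure_eq_measure)
qed (simp only: sets_distr sets_measure_pmf sets_count_space Pow_UNIV)

section \<open>Ties and product laws\<close>

text \<open>By Fubini, integrate over coordinate \<open>i\<close> first: with the others frozen,
  equality pins it to one point, which is null for \<open>\<kappa>\<close>.\<close>

lemma AE_PiM_shifted_coordinate_neq:
  fixes \<kappa> :: "real measure"
  assumes "finite I" "i \<in> I" "j \<in> I" "i \<noteq> j" and \<kappa>: "prob_space \<kappa>" "sets \<kappa> = sets borel"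
    and null: "\<And>x. emeasure \<kappa> {x} = 0"
  shows "AE u in PiM I (\<lambda>_. \<kappa>). u i \<noteq> u j + c"
proof -
  interpret \<kappa>: prob_space \<kappa> by fact
  interpret product_prob_space "\<lambda>_. \<kappa>" by unfold_locales
  let ?J = "I - {i}" let ?E = "{u \<in> space (PiM I (\<lambda>_. \<kappa>)). u i = u j + c}"
  have I: "I = insert i ?J" "finite ?J" "i \<notin> ?J" using assms by auto
  have [measurable]: "(\<lambda>u. u i) \<in> borel_measurable (PiM I (\<lambda>_. \<kappa>))" "(\<lambda>u. u j) \<in> borel_measurable (PiM I (\<lambda>_. \<kappa>))"
    using measurable_component_singleton[of i I "\<lambda>_. \<kappa>"] measurable_component_singleton[of j I "\<lambda>_. \<kappa>"] assms(2,3)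
    by (simp_all add: measurable_cong_sets[OF refl \<kappa>(2)])
  have E: "?E \<in> sets (PiM I (\<lambda>_. \<kappa>))" by measurable
  have "emeasure (PiM I (\<lambda>_. \<kappa>)) ?E = (\<integral>\<^sup>+u. indicator ?E u \<partial>PiM (insert i ?J) (\<lambda>_. \<kappa>))"
    using E I by simp
  also have "\<dots> = (\<integral>\<^sup>+x. (\<integral>\<^sup>+y. indicator ?E (x(i := y)) \<partial>\<kappa>) \<partial>PiM ?J (\<lambda>_. \<kappa>))"
    using E I by (intro product_nn_integral_insert) auto
  also have "\<dots> = (\<integral>\<^sup>+x. 0 \<partial>PiM ?J (\<lambda>_. \<kappa>))"
  proof (rule nn_integral_cong)
    fix x assume "x \<in> space (PiM ?J (\<lambda>_. \<kappa>))"
    \<comment> \<open>Since \<open>i \<noteq> j\<close>, updating coordinate \<open>i\<close> leaves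
      \<open>x j\<close> unchanged.\<close>
    have "(\<integral>\<^sup>+y. indicator ?E (x(i := y)) \<partial>\<kappa>) \<le> (\<integral>\<^sup>+y. indicator {x j + c} y \<partial>\<kappa>)"
      using assms(4) by (intro nn_integral_mono) (auto simp: indicator_def)
    also have "\<dots> = 0" using null by (simp add: \<kappa>(2))
    finally show "(\<integral>\<^sup>+y. indicator ?E (x(i := y)) \<partial>\<kappa>) = 0" by simp
  qed
  finally show ?thesis
    using E by (subst AE_iff_null) (auto simp: null_sets_def)
qed

text \<open>Independence factorizes the probability of each measurable rectangle, and rectangles
  determine a product of probability measures.\<close>

lemma distr_pair_indep_rvs:
  assumes "prob_space M" "indep_rvs M S A T B"
  shows "distr M (S \<Otimes>\<^sub>M T) (\<lambda>\<omega>. (A \<omega>, B \<omega>)) = distr M S A \<Otimes>\<^sub>M distr M T B"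
proof -
  interpret prob_space M by fact
  have [measurable]: "A \<in> measurable M S" "B \<in> measurable M T"
    and ind: "indep_set {A -` E \<inter> space M |E. E \<in> sets S} {B -` E \<inter> space M |E. E \<in> sets T}"
    using assms(2) by (auto simp: indep_rvs_def)
  interpret A: prob_space "distr M S A" by (rule prob_space_distr) simp
  interpret B: prob_space "distr M T B" by (rule prob_space_distr) simp
  show ?thesis
  proof (rule pair_measure_eqI[symmetric])
    fix E F assume "E \<in> sets (distr M S A)" "F \<in> sets (distr M T B)"
    then have EF[measurable]: "E \<in> sets S" "F \<in> sets T" by auto
    have "(\<lambda>\<omega>. (A \<omega>, B \<omega>)) -` (E \<times> F) \<inter> space M = (A -` E \<inter> space M) \<inter> (B -` F \<inter> space M)"
      by auto
    then have "emeasure (distr M (S \<Otimes>\<^sub>M T) (\<lambda>\<omega>. (A \<omega>, B \<omega>))) (E \<times> F)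
        = emeasure M ((A -` E \<inter> space M) \<inter> (B -` F \<inter> space M))"
      by (simp add: emeasure_distr)
    also have "\<dots> = emeasure M (A -` E \<inter> space M) * emeasure M (B -` F \<inter> space M)"
    proof -
      have "prob ((A -` E \<inter> space M) \<inter> (B -` F \<inter> space M)) = prob (A -` E \<inter> space M) * prob (B -` F \<inter> space M)"
        by (rule indep_setD[OF ind]) (use EF in blast)+
      then show ?thesis by (simp only: emeasure_eq_measure ennreal_mult measure_nonneg)
    qed
    finally show "emeasure (distr M S A) E * emeasure (distr M T B) F
        = emeasure (distr M (S \<Otimes>\<^sub>M T) (\<lambda>\<omega>. (A \<omega>, B \<omega>))) (E \<times> F)"
      by (simp add: emeasure_distr)
  qed (auto intro: A.sigma_finite_measure_axioms B.sigma_finite_measure_axioms)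
qed

text \<open>The condition \<open>I \<noteq> {}\<close> is where \<open>n \<ge> 1\<close> and
  \<open>m \<ge> 1\<close> enter.\<close>

lemma iid_distr:
  assumes "prob_space M" "iid M Z P I X" "I \<noteq> {}"
  shows "distr M (PiM I (\<lambda>_. Z)) (\<lambda>\<omega>. \<lambda>i\<in>I. X i \<omega>) = PiM I (\<lambda>_. P)"
proof -
  interpret prob_space M by fact
  have ind: "indep_vars (\<lambda>_. Z) X I" and P: "\<And>i. i \<in> I \<Longrightarrow> distr M Z (X i) = P"
    using assms(2) by (auto simp: iid_def)
  from ind have "random_variable Z (X i)" if "i \<in> I" for i
    using that by (auto simp: indep_vars_def)
  with ind have "distr M (PiM I (\<lambda>_. Z)) (\<lambda>\<omega>. \<lambda>i\<in>I. X i \<omega>) = PiM I (\<lambda>i. distr M Z (X i))"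
    using indep_vars_iff_distr_eq_PiM'[OF assms(3), of X "\<lambda>_. Z"] by simp
  also have "\<dots> = PiM I (\<lambda>_. P)" by (rule PiM_cong) (simp_all add: P)
  finally show ?thesis .
qed

lemma uniform_interval_singleton: "emeasure (uniform_measure lborel {-1..1::real}) {x} = 0"
proof -
  have "emeasure lborel ({-1..1} \<inter> {x}) \<le> emeasure lborel {x}" by (rule emeasure_mono) auto
  then show ?thesis by simp
qed

section \<open>The law of the pooled sample\<close>

lemma pooled_in_PiE_iff:
  "pooled n m x y \<in> Pi\<^sub>E {1..n + m} A \<longleftrightarrow> (\<forall>i\<in>{1..n}. x i \<in> A i) \<and> (\<forall>j\<in>{1..m}. y j \<in> A (n + j))"
proof -
  have "(\<forall>i\<in>{n + 1..n + m}. y (i - n) \<in> A i) \<longleftrightarrow> (\<forall>j\<in>{1..m}. y j \<in> A (n + j))"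
  proof -
    \<comment> \<open>The interval is written as an image so that the bounded quantifier reindexes;
      the deleted simp rule would turn the image back into an interval.\<close>
    have image: "{n + 1..n + m} = (\<lambda>j. n + j) ` {1..m}" by simp
    show ?thesis unfolding image by (simp del: image_add_atLeastAtMost)
  qed
  moreover have "{1..n + m} = {1..n} \<union> {n + 1..n + m}" by auto
  moreover have "i \<in> {n + 1..n + m} \<Longrightarrow> \<not> i \<le> n" for i by simp
  ultimately show ?thesis
    by (simp only: pooled_def restrict_PiE_iff ball_Un) auto
qed

text \<open>Boxes determine the product law. A box for the pooled sample splits into an
  \<open>X\<close> box and a \<open>Y\<close> box, and independence between and within the samples
  factorizes its probability.\<close>

lemma distr_pooled:
  assumes "two_sample_model M Z P P n m X Y U" "n \<ge> 1" "m \<ge> 1"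
  shows "distr M (PiM {1..n + m} (\<lambda>_. Z)) (\<lambda>\<omega>. pooled n m (\<lambda>i. X i \<omega>) (\<lambda>i. Y i \<omega>))
    = PiM {1..n + m} (\<lambda>_. P)"
proof -
  interpret two_sample_model M Z P P n m X Y U by fact
  interpret Q: prob_space P by (rule prob_P_X)
  interpret Q: product_sigma_finite "\<lambda>_. P"
    by (intro product_sigma_finite.intro Q.sigma_finite_measure_axioms)
  let ?D = "\<lambda>\<omega>. pooled n m (\<lambda>i. X i \<omega>) (\<lambda>i. Y i \<omega>)"
  let ?X = "\<lambda>\<omega>. \<lambda>i\<in>{1..n}. X i \<omega>" let ?Y = "\<lambda>\<omega>. \<lambda>i\<in>{1..m}. Y i \<omega>"
  let ?PX = "PiM {1..n} (\<lambda>_. Z)" let ?PY = "PiM {1..m} (\<lambda>_. Z)"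
  have sPZ: "sets (PiM I (\<lambda>_. Z)) = sets (PiM I (\<lambda>_. P))" for I :: "nat set"
    by (rule sets_PiM_cong) (simp_all add: sets_P_X)
  have D: "?D \<in> measurable M (PiM {1..n + m} (\<lambda>_. Z))"
    using indep_data_U by (simp add: indep_rvs_def)
  note XY = indep_X_Y[unfolded indep_var_distribution_eq]
  have X: "?X \<in> measurable M ?PX" and Y: "?Y \<in> measurable M ?PY" using XY by auto
  have joint: "distr M (?PX \<Otimes>\<^sub>M ?PY) (\<lambda>\<omega>. (?X \<omega>, ?Y \<omega>)) = PiM {1..n} (\<lambda>_. P) \<Otimes>\<^sub>M PiM {1..m} (\<lambda>_. P)"
    using XY iid_distr[OF prob_space_axioms iid_X] iid_distr[OF prob_space_axioms iid_Y] assms(2,3) by simp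
  show ?thesis
  proof (rule Q.PiM_eqI)
    show "sets (distr M (PiM {1..n + m} (\<lambda>_. Z)) ?D) = sets (PiM {1..n + m} (\<lambda>_. P))" by (simp add: sPZ)
    fix A :: "nat \<Rightarrow> 'b set" assume A: "\<And>i. i \<in> {1..n + m} \<Longrightarrow> A i \<in> sets P"
    have AX: "Pi\<^sub>E {1..n} A \<in> sets (PiM {1..n} (\<lambda>_. P))"
      using A by (intro sets_PiM_I_finite) auto
    have AY: "Pi\<^sub>E {1..m} (\<lambda>j. A (n + j)) \<in> sets (PiM {1..m} (\<lambda>_. P))"
      using A by (intro sets_PiM_I_finite) auto
    have AD: "Pi\<^sub>E {1..n + m} A \<in> sets (PiM {1..n + m} (\<lambda>_. Z))"
      unfolding sPZ using A by (intro sets_PiM_I_finite) auto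
    interpret Y: prob_space "PiM {1..m} (\<lambda>_. P)" by (intro prob_space_PiM prob_P_X)
    have "emeasure (distr M (PiM {1..n + m} (\<lambda>_. Z)) ?D) (Pi\<^sub>E {1..n + m} A)
        = emeasure M (?D -` (Pi\<^sub>E {1..n + m} A) \<inter> space M)"
      using D AD by (rule emeasure_distr)
    also have "?D -` (Pi\<^sub>E {1..n + m} A) \<inter> space M
        = (\<lambda>\<omega>. (?X \<omega>, ?Y \<omega>)) -` (Pi\<^sub>E {1..n} A \<times> Pi\<^sub>E {1..m} (\<lambda>j. A (n + j))) \<inter> space M"
      by (auto simp only: vimage_def pooled_in_PiE_iff mem_Collect_eq mem_Times_iff restrict_PiE_iff fst_conv snd_conv)
    also have "emeasure M \<dots> = emeasure (distr M (?PX \<Otimes>\<^sub>M ?PY) (\<lambda>\<omega>. (?X \<omega>, ?Y \<omega>)))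
        (Pi\<^sub>E {1..n} A \<times> Pi\<^sub>E {1..m} (\<lambda>j. A (n + j)))"
      using X Y AX AY by (intro emeasure_distr[symmetric]) (auto simp: sPZ)
    also have "\<dots> = emeasure (PiM {1..n} (\<lambda>_. P)) (Pi\<^sub>E {1..n} A)
        * emeasure (PiM {1..m} (\<lambda>_. P)) (Pi\<^sub>E {1..m} (\<lambda>j. A (n + j)))"
      unfolding joint using AX AY by (rule Y.emeasure_pair_measure_Times)
    also have "\<dots> = (\<Prod>i\<in>{1..n}. emeasure P (A i)) * (\<Prod>j\<in>{1..m}. emeasure P (A (n + j)))"
      using A by (intro arg_cong2[where f = "(*)"] Q.emeasure_PiM) auto
    also have "(\<Prod>j\<in>{1..m}. emeasure P (A (n + j))) = (\<Prod>j\<in>{n + 1..n + m}. emeasure P (A j))"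
      by (rule prod.reindex_bij_witness[of _ "\<lambda>j. j - n" "\<lambda>j. n + j"]) auto
    also have "(\<Prod>i\<in>{1..n}. emeasure P (A i)) * \<dots> = (\<Prod>i\<in>{1..n + m}. emeasure P (A i))"
      by (subst prod.union_disjoint[symmetric]) (auto intro!: prod.cong)
    finally show "emeasure (distr M (PiM {1..n + m} (\<lambda>_. Z)) ?D) (Pi\<^sub>E {1..n + m} A)
        = (\<Prod>i\<in>{1..n + m}. emeasure P (A i))" .
  qed simp
qed

section \<open>The rank sum law on the canonical product space\<close>

text \<open>Data and tie-breakers are here the coordinates of \<open>\<nu>\<close>. It remains to
  check exchangeability and absence of ties for \<open>W\<close>; of the tie-breaker law
  \<open>\<kappa>\<close>, only that it is an atomless probability on the reals is used.\<close>

lemma distr_raw_rank_sum_iid: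
  fixes P :: "'z measure" and f :: "'z \<Rightarrow> (nat \<Rightarrow> 'z) \<Rightarrow> real"
  assumes P: "prob_space P" and \<kappa>: "prob_space \<kappa>" "sets \<kappa> = sets borel" "\<And>x. emeasure \<kappa> {x} = 0"
    and "\<xi> > 0" "n \<le> N"
    and f: "(\<lambda>(z, d). f z d) \<in> borel_measurable (P \<Otimes>\<^sub>M PiM {1..N} (\<lambda>_. P))"
    and perm: "perm_invariant P N f"
  defines "\<nu> \<equiv> PiM {1..N} (\<lambda>_. P) \<Otimes>\<^sub>M PiM {1..N} (\<lambda>_. \<kappa>)"
  shows "(\<lambda>(d, u). raw_rank_sum n N (\<lambda>i. f (d i) d + \<xi> * u i)) \<in> measurable \<nu> (count_space UNIV)"
    and "distr \<nu> (count_space UNIV) (\<lambda>(d, u). raw_rank_sum n N (\<lambda>i. f (d i) d + \<xi> * u i))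
      = measure_pmf (null_rank_sum n N)"
proof -
  let ?I = "{1..N}" let ?B = "PiM ?I (\<lambda>_. borel :: real measure)"
  let ?PD = "PiM ?I (\<lambda>_. P)" let ?PU = "PiM ?I (\<lambda>_. \<kappa>)"
  interpret D: prob_space ?PD by (intro prob_space_PiM P)
  interpret U: prob_space ?PU by (intro prob_space_PiM \<kappa>)
  interpret DU: pair_prob_space ?PD ?PU ..
  interpret prob_space \<nu> unfolding \<nu>_def by (rule DU.prob_space_axioms)
  define W where "W = (\<lambda>(d, u). \<lambda>i\<in>?I. f (d i) d + \<xi> * u i)"
  have W: "W \<in> measurable \<nu> ?B"
    unfolding W_def case_prod_beta
  proof (rule measurable_restrict)
    fix i assume i: "i \<in> ?I"
    have "(\<lambda>p. (fst p i, fst p)) \<in> measurable \<nu> (P \<Otimes>\<^sub>M ?PD)"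
      unfolding \<nu>_def using i by measurable
    from measurable_compose[OF this f]
    have [measurable]: "(\<lambda>p. f (fst p i) (fst p)) \<in> borel_measurable \<nu>" by simp
    have "(\<lambda>p. snd p i) \<in> measurable \<nu> \<kappa>" unfolding \<nu>_def using i by measurable
    then have [measurable]: "(\<lambda>p. snd p i) \<in> borel_measurable \<nu>"
      by (simp add: measurable_cong_sets[OF refl \<kappa>(2)])
    show "(\<lambda>p. f (fst p i) (fst p) + \<xi> * snd p i) \<in> borel_measurable \<nu>" by measurable
  qed
  have RW: "(\<lambda>(d, u). raw_rank_sum n N (\<lambda>i. f (d i) d + \<xi> * u i)) = (\<lambda>p. raw_rank_sum n N (W p))"
    using \<open>n \<le> N\<close> by (auto simp: W_def fun_eq_iff intro!: raw_rank_sum_cong)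
  show "(\<lambda>(d, u). raw_rank_sum n N (\<lambda>i. f (d i) d + \<xi> * u i)) \<in> measurable \<nu> (count_space UNIV)"
    unfolding RW using W measurable_raw_rank_sum[OF \<open>n \<le> N\<close>] by (rule measurable_compose)
  show "distr \<nu> (count_space UNIV) (\<lambda>(d, u). raw_rank_sum n N (\<lambda>i. f (d i) d + \<xi> * u i))
      = measure_pmf (null_rank_sum n N)"
    unfolding RW
  proof (rule distr_raw_rank_sum_exchangeable[OF \<open>n \<le> N\<close> W])
    fix \<pi> assume \<pi>: "\<pi> permutes ?I"
    have \<pi>I: "\<pi> \<in> ?I \<rightarrow> ?I" using permutes_in_image[OF \<pi>] by auto
    have inj: "inj_on \<pi> ?I" using permutes_inj_on[OF \<pi>] .
    let ?T = "\<lambda>d. \<lambda>i\<in>?I. d (\<pi> i)"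
    have TD: "distr ?PD ?PD ?T = ?PD"
      using distr_PiM_reindex[of ?I "\<lambda>_. P" \<pi> ?I] P inj \<pi>I by simp
    have TU: "distr ?PU ?PU ?T = ?PU"
      using distr_PiM_reindex[of ?I "\<lambda>_. \<kappa>" \<pi> ?I] \<kappa> inj \<pi>I by simp
    have mD: "?T \<in> measurable ?PD ?PD" and mU: "?T \<in> measurable ?PU ?PU"
      using \<pi>I by (auto intro!: measurable_restrict measurable_component_singleton)
    \<comment> \<open>Data and tie-breakers are permuted by the same \<open>\<pi>\<close>, so each
      value keeps its own tie-breaker.\<close>
    have T: "distr \<nu> \<nu> (\<lambda>(d, u). (?T d, ?T u)) = \<nu>"
      unfolding \<nu>_def using pair_measure_distr[OF mD mU] TD TU U.sigma_finite_measure_axioms by simp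
    have mT: "(\<lambda>(d, u). (?T d, ?T u)) \<in> measurable \<nu> \<nu>"
      unfolding \<nu>_def case_prod_beta using mD mU by measurable
    have "distr \<nu> ?B (\<lambda>p. \<lambda>i\<in>?I. W p (\<pi> i)) = distr \<nu> ?B (W \<circ> (\<lambda>(d, u). (?T d, ?T u)))"
    proof (rule distr_cong[OF refl refl])
      fix p assume "p \<in> space \<nu>"
      then obtain d u where p: "p = (d, u)" and d: "d \<in> space ?PD"
        by (auto simp: \<nu>_def space_pair_measure)
      \<comment> \<open>The only use of permutation invariance: the fitted function does not see the
        relabelling, so permuting the input of \<open>W\<close> just permutes its output.\<close>
      have "f (d (\<pi> i)) d = f (d (\<pi> i)) (?T d)" if "i \<in> ?I" for i
      proof -
        have "\<pi> i \<in> ?I" using that \<pi>I by blast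
        then have "d (\<pi> i) \<in> space P" using d by (auto simp: space_PiM)
        then show ?thesis using perm d \<pi> unfolding perm_invariant_def by blast
      qed
      then show "(\<lambda>i\<in>?I. W p (\<pi> i)) = (W \<circ> (\<lambda>(d, u). (?T d, ?T u))) p"
        using \<pi>I by (auto simp: W_def p fun_eq_iff)
    qed
    also have "\<dots> = distr (distr \<nu> \<nu> (\<lambda>(d, u). (?T d, ?T u))) ?B W"
      using W mT by (simp add: distr_distr)
    finally show "distr \<nu> ?B (\<lambda>p. \<lambda>i\<in>?I. W p (\<pi> i)) = distr \<nu> ?B W"
      unfolding T .
  next
    have neq: "AE p in \<nu>. W p i \<noteq> W p j" if ij: "i \<in> ?I" "j \<in> ?I" "i \<noteq> j" for i j
    proof -
      have m: "(\<lambda>p. W p k) \<in> borel_measurable \<nu>" if "k \<in> ?I" for k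
        using measurable_compose[OF W measurable_component_singleton[of k ?I "\<lambda>_. borel"]] that by simp
      have "AE d in ?PD. AE u in ?PU. W (d, u) i \<noteq> W (d, u) j"
      proof (rule AE_I2)
        fix d
        show "AE u in ?PU. W (d, u) i \<noteq> W (d, u) j"
          \<comment> \<open>For fixed \<open>d\<close>, a tie means that \<open>u i\<close> equals
            \<open>u j\<close> plus this constant, obtained by dividing by
            \<open>\<xi> > 0\<close>.\<close>
          using AE_PiM_shifted_coordinate_neq[OF _ ij \<kappa>, of "(f (d j) d - f (d i) d) / \<xi>"]
          using ij \<open>\<xi> > 0\<close> by (auto simp: W_def field_simps)
      qed
      moreover have "{p \<in> space \<nu>. W p i \<noteq> W p j} \<in> sets \<nu>"
        using m[OF ij(1)] m[OF ij(2)] by measurable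
      ultimately show ?thesis
        unfolding \<nu>_def by (intro DU.AE_pair_measure) auto
    qed
    \<comment> \<open>There are finitely many pairs, so the exceptional null sets can be
      combined.\<close>
    have "AE p in \<nu>. \<forall>(i, j)\<in>{(i, j) \<in> ?I \<times> ?I. i \<noteq> j}. W p i \<noteq> W p j"
      using neq by (intro AE_finite_allI) (auto intro: finite_subset[of _ "?I \<times> ?I"])
    then show "AE p in \<nu>. inj_on (W p) ?I"
      by eventually_elim (unfold inj_on_def, blast)
  qed
qed

section \<open>Transfer to the two-sample model\<close>

text \<open>The statistic is a fixed map \<open>?R\<close> of data and tie-breakers, whose joint law
  under equal marginals is \<open>?\<nu>\<close>. The resulting law mentions none of
  \<open>P\<close>, \<open>f\<close> and \<open>\<xi>\<close>.\<close>

lemma exch_stat_law: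
  assumes model: "two_sample_model M Z P P n m X Y U"
    and "n \<ge> 1" "m \<ge> 1" "\<xi> > 0"
    and f: "(\<lambda>(z, d). f z d) \<in> borel_measurable (Z \<Otimes>\<^sub>M PiM {1..n + m} (\<lambda>_. Z))"
    and perm: "perm_invariant Z (n + m) f"
  shows "exch_stat \<xi> n m f X Y U \<in> measurable M (count_space UNIV)"
    and "distr M (count_space UNIV) (exch_stat \<xi> n m f X Y U) = measure_pmf (null_rank_sum n (n + m))"
proof -
  interpret two_sample_model M Z P P n m X Y U by fact
  let ?I = "{1..n + m}" let ?\<kappa> = "uniform_measure lborel {-1..1::real}"
  let ?D = "\<lambda>\<omega>. pooled n m (\<lambda>i. X i \<omega>) (\<lambda>i. Y i \<omega>)" let ?U = "\<lambda>\<omega>. \<lambda>i\<in>?I. U i \<omega>"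
  let ?PZ = "PiM ?I (\<lambda>_. Z)" let ?PB = "PiM ?I (\<lambda>_. borel :: real measure)"
  let ?\<nu> = "PiM ?I (\<lambda>_. P) \<Otimes>\<^sub>M PiM ?I (\<lambda>_. ?\<kappa>)"
  let ?R = "\<lambda>(d, u). raw_rank_sum n (n + m) (\<lambda>i. f (d i) d + \<xi> * u i)"
  have \<kappa>: "prob_space ?\<kappa>" "sets ?\<kappa> = sets borel"
    by (auto intro: prob_space_uniform_measure)
  \<comment> \<open>\<open>Z\<close> and \<open>P\<close> share their measurable sets, so the
    hypotheses on \<open>f\<close> carry over from \<open>Z\<close> to \<open>P\<close>.\<close>
  have sPZ: "sets ?PZ = sets (PiM ?I (\<lambda>_. P))"
    by (rule sets_PiM_cong) (simp_all add: sets_P_X)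
  have sZP: "sets (Z \<Otimes>\<^sub>M ?PZ) = sets (P \<Otimes>\<^sub>M PiM ?I (\<lambda>_. P))"
    by (intro sets_pair_measure_cong sPZ sets_P_X[symmetric])
  have fP: "(\<lambda>(z, d). f z d) \<in> borel_measurable (P \<Otimes>\<^sub>M PiM ?I (\<lambda>_. P))"
    using f by (simp only: measurable_cong_sets[OF sZP refl])
  have permP: "perm_invariant P (n + m) f"
    using perm
    by (simp only: perm_invariant_def sets_eq_imp_space_eq[OF sets_P_X] sets_eq_imp_space_eq[OF sPZ])
  note R = distr_raw_rank_sum_iid[OF prob_P_X \<kappa> uniform_interval_singleton \<open>\<xi> > 0\<close> le_add1 fP permP]
  have rv: "?D \<in> measurable M ?PZ" "?U \<in> measurable M ?PB"
    using indep_data_U by (auto simp: indep_rvs_def)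
  then have DU: "(\<lambda>\<omega>. (?D \<omega>, ?U \<omega>)) \<in> measurable M (?PZ \<Otimes>\<^sub>M ?PB)" by measurable
  have law: "distr M (?PZ \<Otimes>\<^sub>M ?PB) (\<lambda>\<omega>. (?D \<omega>, ?U \<omega>)) = ?\<nu>"
    using distr_pair_indep_rvs[OF prob_space_axioms indep_data_U] distr_pooled[OF model assms(2,3)]
      iid_distr[OF prob_space_axioms iid_U] assms(2) by simp
  have sets_\<nu>: "sets (?PZ \<Otimes>\<^sub>M ?PB) = sets ?\<nu>" using arg_cong[OF law, of sets] by (simp only: sets_distr)
  have R1: "?R \<in> measurable (?PZ \<Otimes>\<^sub>M ?PB) (count_space UNIV)"
    using R(1) by (simp only: measurable_cong_sets[OF sets_\<nu> refl])
  have eq: "exch_stat \<xi> n m f X Y U = ?R \<circ> (\<lambda>\<omega>. (?D \<omega>, ?U \<omega>))"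
    by (auto simp: fun_eq_iff exch_stat_def rank_sum_eq_raw_rank_sum Let_def intro!: raw_rank_sum_cong)
  show "exch_stat \<xi> n m f X Y U \<in> measurable M (count_space UNIV)"
    unfolding eq using DU R1 by (rule measurable_comp)
  show "distr M (count_space UNIV) (exch_stat \<xi> n m f X Y U) = measure_pmf (null_rank_sum n (n + m))"
    unfolding eq distr_distr[OF R1 DU, symmetric] law by (rule R(2))
qed

text \<open>The constant choice of the identity as transformation ignores the data, hence is
  trivially permutation invariant.\<close>

lemma wilcoxon_stat_eq_exch_stat:
  "wilcoxon_stat \<xi> n m X Y U = exch_stat \<xi> n m (\<lambda>z d. z) X Y U"
  by (simp add: fun_eq_iff wilcoxon_stat_def exch_stat_def Let_def)

theorem theorem5:
  fixes n m :: nat and \<xi> :: real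
    and M :: "'w measure" and Z P_X P_Y :: "'z measure"
    and X Y :: "nat \<Rightarrow> 'w \<Rightarrow> 'z" and U :: "nat \<Rightarrow> 'w \<Rightarrow> real"
    and f :: "'z \<Rightarrow> (nat \<Rightarrow> 'z) \<Rightarrow> real"
  assumes "n \<ge> 1" and "m \<ge> 1" and "\<xi> > 0"
    and "two_sample_model M Z P_X P_Y n m X Y U"
    and "(\<lambda>(z, d). f z d) \<in> borel_measurable (Z \<Otimes>\<^sub>M PiM {1..n + m} (\<lambda>_. Z))"
    and "perm_invariant Z (n + m) f"
    and H0: "P_X = P_Y"
  shows "exch_stat \<xi> n m f X Y U \<in> measurable M (count_space UNIV)
    \<and> (\<forall>(M' :: 'v measure) P' X' Y' U'.
          two_sample_model M' Z P' P' n m X' Y' U' \<longrightarrow>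
          distr M (count_space UNIV) (exch_stat \<xi> n m f X Y U)
            = distr M' (count_space UNIV) (exch_stat \<xi> n m f X' Y' U'))
    \<and> (\<forall>(M' :: 'u measure) (Q :: real measure) X' Y' U'. \<forall>\<xi>' > 0.
          two_sample_model M' borel Q Q n m X' Y' U' \<longrightarrow>
          distr M (count_space UNIV) (exch_stat \<xi> n m f X Y U)
            = distr M' (count_space UNIV) (wilcoxon_stat \<xi>' n m X' Y' U'))"
proof (intro conjI allI impI)
  \<comment> \<open>Both comparisons instantiate this law twice: the two models may live on
    different spaces and, in the Wilcoxon case, use different scales \<open>\<xi>\<close> and
    \<open>\<xi>'\<close>.\<close>
  note law = exch_stat_law[OF _ assms(1,2)]
  note main = law[OF assms(4)[folded H0] assms(3,5,6)]
  show "exch_stat \<xi> n m f X Y U \<in> measurable M (count_space UNIV)"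
    by (rule main(1))
  show "distr M (count_space UNIV) (exch_stat \<xi> n m f X Y U)
      = distr M' (count_space UNIV) (exch_stat \<xi> n m f X' Y' U')"
    if "two_sample_model M' Z P' P' n m X' Y' U'" for M' :: "'v measure" and P' X' Y' U'
    using main(2) law(2)[OF that assms(3,5,6)] by simp
  show "distr M (count_space UNIV) (exch_stat \<xi> n m f X Y U)
      = distr M' (count_space UNIV) (wilcoxon_stat \<xi>' n m X' Y' U')"
    if "\<xi>' > 0" "two_sample_model M' borel Q Q n m X' Y' U'"
    for M' :: "'u measure" and Q :: "real measure" and X' Y' U' \<xi>'
    unfolding wilcoxon_stat_eq_exch_stat
    using main(2) law(2)[OF that(2,1), of "\<lambda>z d. z"] by (simp add: perm_invariant_def case_prod_beta)
qed

end
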